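(* There is an infinite class $\Phi$ of CNFs such that every $\varphi \in \Phi$ can be represented by a $\wedge_d$-OBDD of size polynomial in $|\mathsf{var}(\varphi)|$, while every OBDD representing $\varphi$ has size exponential in a power of $|\mathsf{var}(\varphi)|$, i.e. at least $2^{\Omega(|\mathsf{var}(\varphi)|^{c})}$ for some absolute constant $c>0$.
   Context: An assignment ${\bf a}$ is a map from a finite set of variables $\mathsf{var}({\bf a})$ to $\{0,1\}$, identified with the set of pairs $(x,{\bf a}(x))$. For sets $\mathcal{H}_1,\mathcal{H}_2$ of assignments over disjoint variable sets, $\mathcal{H}_1\times\mathcal{H}_2=\{{\bf a}\cup{\bf b}: {\bf a}\in\mathcal{H}_1,{\bf b}\in\mathcal{H}_2\}$. A $\wedge_d$-FBDD is a directed acyclic graph $B$ with a single source and two sinks labelled ${\bf 0}$ and ${\bf 1}$; every non-sink node has two children and is either a conjunction node or a decision node labelled by a variable, whose two outgoing edges are labelled $0$ and $1$. For a node $u$, $B_u$ is the sub-DAG of nodes reachable from $u$, and $\mathsf{var}(B_u)$ is the set of variables labelling decision nodes of $B_u$. It is required that (decomposability) for every conjunction node with children $u_0,u_1$, $\mathsf{var}(B_{u_0})\cap\mathsf{var}(B_{u_1})=\emptyset$, and (read-once) no directed path contains two decision nodes labelled by the same variable. The size is the number of nodes. The set $\mathcal{A}(B)$ of accepted assignments is defined recursively: for a single ${\bf 1}$-sink it is $\{\emptyset\}$, for a single ${\bf 0}$-sink it is $\emptyset$; if the source is a decision node labelled $x$ with $0$-child $u_0$ and $1$-child $u_1$, then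 $\mathcal{A}(B)=\mathcal{A}(B_{u_0})\times\{(x,0)\}\cup\mathcal{A}(B_{u_1})\times\{(x,1)\}$; if the source is a conjunction node with children $u_0,u_1$, then $\mathcal{A}(B)=\mathcal{A}(B_{u_0})\times\mathcal{A}(B_{u_1})$. The function $f(B)$ is the Boolean function on $\mathsf{var}(B)$ whose satisfying assignments are those extending some element of $\mathcal{A}(B)$; $B$ represents $f$ if $f(B)=f$. A CNF $\varphi$ is regarded as a Boolean function on the set $\mathsf{var}(\varphi)$ of variables occurring in it. A $\wedge_d$-OBDD is a $\wedge_d$-FBDD $B$ for which there is a linear order $\pi$ of a superset of $\mathsf{var}(B)$ such that along every directed path the labels of decision nodes appear in increasing $\pi$-order. An OBDD is a $\wedge_d$-OBDD with no conjunction nodes. *)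

theory Defs
  imports Complex_Main "HOL-Computational_Algebra.Polynomial"
begin

section \<open>Assignments and Boolean functions\<close>

text \<open>The identification of an assignment with a set of pairs is that of a partial map with its
  graph; on maps with disjoint domains, \<^term>\<open>a ++ b\<close> is the union of the graphs.\<close>

type_synonym 'v assignment = "'v \<rightharpoonup> bool"

definition assignments_prod ::
    "'v assignment set \<Rightarrow> 'v assignment set \<Rightarrow> 'v assignment set" where
  "assignments_prod H1 H2 = {a ++ b |a b. a \<in> H1 \<and> b \<in> H2}"

text \<open>A Boolean function is a set of variables together with the set of satisfying assignments,
  whose domains are exactly that set. Equality of functions thus includes equality of the
  sets of variables.\<close>

type_synonym 'v boolean_function = "'v set \<times> 'v assignment set"


section \<open>CNFs\<close>

text \<open>\<^term>\<open>(x, True)\<close> is the positive and \<^term>\<open>(x, False)\<close> the negative literal of \<^term>\<open>x\<close>.\<close>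

type_synonym 'v clause = "('v \<times> bool) set"
type_synonym 'v cnf = "'v clause set"

definition is_cnf :: "'v cnf \<Rightarrow> bool" where
  "is_cnf \<phi> \<longleftrightarrow> finite \<phi> \<and> (\<forall>C\<in>\<phi>. finite C)"

definition cnf_vars :: "'v cnf \<Rightarrow> 'v set" where
  "cnf_vars \<phi> = (\<Union>C\<in>\<phi>. fst ` C)"

definition cnf_function :: "'v cnf \<Rightarrow> 'v boolean_function" where
  "cnf_function \<phi> =
     (cnf_vars \<phi>, {a. dom a = cnf_vars \<phi> \<and> (\<forall>C\<in>\<phi>. \<exists>(x, b)\<in>C. a x = Some b)})"


section \<open>Decomposable branching programs\<close>

text \<open>\<^term>\<open>Decision x u0 u1\<close> has \<open>0\<close>-child \<^term>\<open>u0\<close> and \<open>1\<close>-child \<^term>\<open>u1\<close>. The two children of a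
  node may coincide (parallel edges), as is usual for branching programs. Only the values of
  \<open>label\<close> on \<open>nodes\<close> matter.\<close>

datatype ('n, 'v) node_label =
  Sink bool
| Decision 'v 'n 'n
| Conjunction 'n 'n

record ('n, 'v) bp =
  nodes :: "'n set"
  label :: "'n \<Rightarrow> ('n, 'v) node_label"

fun children :: "('n, 'v) node_label \<Rightarrow> 'n set" where
  "children (Sink b) = {}"
| "children (Decision x u0 u1) = {u0, u1}"
| "children (Conjunction u0 u1) = {u0, u1}"

definition edges :: "('n, 'v) bp \<Rightarrow> ('n \<times> 'n) set" where
  "edges B = {(u, v). u \<in> nodes B \<and> v \<in> children (label B u)}"

definition is_source :: "('n, 'v) bp \<Rightarrow> 'n \<Rightarrow> bool" where
  "is_source B s \<longleftrightarrow> s \<in> nodes B \<and> s \<notin> Range (edges B)"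

definition source :: "('n, 'v) bp \<Rightarrow> 'n" where
  "source B = (THE s. is_source B s)"

definition bp_size :: "('n, 'v) bp \<Rightarrow> nat" where
  "bp_size B = card (nodes B)"

definition decision_on :: "('n, 'v) bp \<Rightarrow> 'n \<Rightarrow> 'v \<Rightarrow> bool" where
  "decision_on B u x \<longleftrightarrow> u \<in> nodes B \<and> (\<exists>u0 u1. label B u = Decision x u0 u1)"

definition vars_below :: "('n, 'v) bp \<Rightarrow> 'n \<Rightarrow> 'v set" where
  "vars_below B u = {x. \<exists>v. (u, v) \<in> (edges B)\<^sup>* \<and> decision_on B v x}"

definition bp_vars :: "('n, 'v) bp \<Rightarrow> 'v set" where
  "bp_vars B = vars_below B (source B)"

definition decomposable :: "('n, 'v) bp \<Rightarrow> bool" where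
  "decomposable B \<longleftrightarrow>
     (\<forall>u\<in>nodes B. \<forall>u0 u1. label B u = Conjunction u0 u1 \<longrightarrow>
        vars_below B u0 \<inter> vars_below B u1 = {})"

definition read_once :: "('n, 'v) bp \<Rightarrow> bool" where
  "read_once B \<longleftrightarrow>
     (\<forall>u v x y. (u, v) \<in> (edges B)\<^sup>+ \<and> decision_on B u x \<and> decision_on B v y \<longrightarrow> x \<noteq> y)"

text \<open>There is at most one sink of each label, rather than exactly one: a sink that is not
  reachable may be missing. This is needed for the sub-DAGs \<open>B\<^sub>u\<close> (such as a single sink) to be
  branching programs themselves, and for constant functions to be representable without
  conjunction nodes.\<close>

definition is_wedge_d_fbdd :: "('n, 'v) bp \<Rightarrow> bool" where
  "is_wedge_d_fbdd B \<longleftrightarrow>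
     finite (nodes B) \<and>
     (\<forall>u\<in>nodes B. children (label B u) \<subseteq> nodes B) \<and>
     acyclic (edges B) \<and>
     (\<exists>!s. is_source B s) \<and>
     (\<forall>u\<in>nodes B. \<forall>v\<in>nodes B. \<forall>b. label B u = Sink b \<and> label B v = Sink b \<longrightarrow> u = v) \<and>
     decomposable B \<and>
     read_once B"

definition is_wedge_d_obdd :: "('n, 'v) bp \<Rightarrow> bool" where
  "is_wedge_d_obdd B \<longleftrightarrow>
     is_wedge_d_fbdd B \<and>
     (\<exists>V \<pi>. linear_order_on V \<pi> \<and> bp_vars B \<subseteq> V \<and>
        (\<forall>u v x y. (u, v) \<in> (edges B)\<^sup>+ \<and> decision_on B u x \<and> decision_on B v y \<longrightarrow>
           (x, y) \<in> \<pi> \<and> x \<noteq> y))"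

definition is_obdd :: "('n, 'v) bp \<Rightarrow> bool" where
  "is_obdd B \<longleftrightarrow>
     is_wedge_d_obdd B \<and> (\<forall>u\<in>nodes B. \<forall>u0 u1. label B u \<noteq> Conjunction u0 u1)"

text \<open>\<open>accepted B u\<close> is \<open>\<A>(B\<^sub>u)\<close>. On a finite acyclic \<open>B\<close> the least fixed point is the only
  solution of the recursive equations \<open>accepted_recursion\<close> below.\<close>

inductive accepts :: "('n, 'v) bp \<Rightarrow> 'n \<Rightarrow> 'v assignment \<Rightarrow> bool" for B where
  one_sink: "label B u = Sink True \<Longrightarrow> accepts B u Map.empty"
| decision_0: "label B u = Decision x u0 u1 \<Longrightarrow> accepts B u0 a \<Longrightarrow> accepts B u (a ++ [x \<mapsto> False])"
| decision_1: "label B u = Decision x u0 u1 \<Longrightarrow> accepts B u1 a \<Longrightarrow> accepts B u (a ++ [x \<mapsto> True])"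
| conjunction: "label B u = Conjunction u0 u1 \<Longrightarrow> accepts B u0 a \<Longrightarrow> accepts B u1 b \<Longrightarrow>
    accepts B u (a ++ b)"

definition accepted :: "('n, 'v) bp \<Rightarrow> 'n \<Rightarrow> 'v assignment set" where
  "accepted B u = {a. accepts B u a}"

lemma accepted_recursion:
  "label B u = Sink True \<Longrightarrow> accepted B u = {Map.empty}"
  "label B u = Sink False \<Longrightarrow> accepted B u = {}"
  "label B u = Decision x u0 u1 \<Longrightarrow>
     accepted B u =
       assignments_prod (accepted B u0) {[x \<mapsto> False]} \<union>
       assignments_prod (accepted B u1) {[x \<mapsto> True]}"
  "label B u = Conjunction u0 u1 \<Longrightarrow>
     accepted B u = assignments_prod (accepted B u0) (accepted B u1)"
  unfolding accepted_def assignments_prod_def set_eq_iff Un_iff mem_Collect_eq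
  by (subst accepts.simps, fastforce)+

definition bp_function :: "('n, 'v) bp \<Rightarrow> 'v boolean_function" where
  "bp_function B =
     (bp_vars B, {a. dom a = bp_vars B \<and> (\<exists>b\<in>accepted B (source B). b \<subseteq>\<^sub>m a)})"

definition represents :: "('n, 'v) bp \<Rightarrow> 'v boolean_function \<Rightarrow> bool" where
  "represents B f \<longleftrightarrow> bp_function B = f"

end

theory Submission
  imports Defs "HOL-Library.Countable"
begin

text \<open>The pairs \<open>{i, j}\<close> of vertices below \<open>N = 2 * m\<close> are split by their sum into \<open>4 * m\<close>
  matchings, and the CNF demands that at most one selector be true and that each pair of a
  selected matching be covered by a true vertex. A program with conjunctions reads the selectors
  first and then checks the pairs of the selected matching independently. An OBDD reads, by some
  point, exactly \<open>m\<close> of the vertices; of the \<open>m\<^sup>2\<close> pairs crossing this cut at least \<open>m / 4\<close> lie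
  in one matching, and selecting it forces the OBDD to remember the left ends of all of them.\<close>

section \<open>Evaluation under total assignments\<close>

text \<open>A single fixed matching would not separate the models: an order that lists the two ends
  of each pair next to each other gives a small OBDD. Since the order may be chosen after the CNF is
  known, the CNF has to offer, for every order, a matching which that order splits badly. Grouping
  by sum covers all pairs by few matchings (a vertex has at most one partner for a given sum), and
  averaging then finds the bad one. Conjunctions remove the need to place partners together, since
  disjoint pairs can be tested independently under any fixed order. Allowing at most one true
  selector keeps that program small: it has to remember only one sum. With
  \<open>3 * N = 6 * m\<close> variables and at least \<open>m / 4\<close> split pairs, the exponent
  is at least 1/24 of the number of variables, so even the power \<open>c = 1\<close> is
  reached.\<close>

definition holds :: "('n, 'v) bp \<Rightarrow> 'n \<Rightarrow> ('v \<Rightarrow> bool) \<Rightarrow> bool" where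
  "holds B u \<alpha> \<longleftrightarrow> (\<exists>b. accepts B u b \<and> b \<subseteq>\<^sub>m (Some \<circ> \<alpha>))"

lemma child_edge: "u \<in> nodes B \<Longrightarrow> v \<in> children (label B u) \<Longrightarrow> (u, v) \<in> edges B"
  by (simp add: edges_def)

lemma vars_below_child: "(u, v) \<in> edges B \<Longrightarrow> vars_below B v \<subseteq> vars_below B u"
  by (auto simp: vars_below_def intro: converse_rtrancl_into_rtrancl)

lemma decision_in_vars_below:
  "u \<in> nodes B \<Longrightarrow> label B u = Decision x u0 u1 \<Longrightarrow> x \<in> vars_below B u"
  by (auto simp: vars_below_def decision_on_def)

lemma nodes_closed:
  assumes "is_wedge_d_fbdd B" "u \<in> nodes B" "v \<in> children (label B u)"
  shows "v \<in> nodes B"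
  using assms by (auto simp: is_wedge_d_fbdd_def)

lemma dom_accepts:
  assumes "is_wedge_d_fbdd B" "accepts B u a" "u \<in> nodes B"
  shows "dom a \<subseteq> vars_below B u"
  using assms(2,3)
proof (induction rule: accepts.induct)
  case (decision_0 u x u0 u1 a)
  then have "dom a \<subseteq> vars_below B u0" "vars_below B u0 \<subseteq> vars_below B u"
    using nodes_closed[OF assms(1)] by (simp_all add: vars_below_child child_edge)
  then show ?case
    using decision_in_vars_below[OF decision_0.prems decision_0.hyps(1)] unfolding dom_map_add by auto
next
  case (decision_1 u x u0 u1 a)
  then have "dom a \<subseteq> vars_below B u1" "vars_below B u1 \<subseteq> vars_below B u"
    using nodes_closed[OF assms(1)] by (simp_all add: vars_below_child child_edge)
  then show ?case
    using decision_in_vars_below[OF decision_1.prems decision_1.hyps(1)] unfolding dom_map_add by auto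
next
  case (conjunction u u0 u1 a b)
  then have "dom a \<subseteq> vars_below B u0" "vars_below B u0 \<subseteq> vars_below B u"
    "dom b \<subseteq> vars_below B u1" "vars_below B u1 \<subseteq> vars_below B u"
    using nodes_closed[OF assms(1)] by (simp_all add: vars_below_child child_edge)
  then show ?case
    by auto
qed simp

text \<open>Read-once seen from a single edge. It ensures that adding the value of \<open>x\<close>
  to an assignment accepted at a child never overwrites anything.\<close>

lemma decision_not_below_child:
  assumes "is_wedge_d_fbdd B" "u \<in> nodes B" "label B u = Decision x u0 u1" "v \<in> {u0, u1}"
  shows "x \<notin> vars_below B v"
proof
  assume "x \<in> vars_below B v"
  then obtain w where w: "(v, w) \<in> (edges B)\<^sup>*" "decision_on B w x"
    by (auto simp: vars_below_def)
  have "(u, v) \<in> edges B"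
    using assms by (intro child_edge) auto
  then have "(u, w) \<in> (edges B)\<^sup>+"
    using w(1) by (rule rtrancl_into_trancl2)
  moreover have "decision_on B u x"
    using assms by (auto simp: decision_on_def)
  ultimately show False
    using assms(1) w(2) unfolding is_wedge_d_fbdd_def read_once_def by blast
qed

lemma map_add_le_iff:
  assumes "dom a \<inter> dom b = {}"
  shows "a ++ b \<subseteq>\<^sub>m c \<longleftrightarrow> a \<subseteq>\<^sub>m c \<and> b \<subseteq>\<^sub>m c"
proof
  assume *: "a ++ b \<subseteq>\<^sub>m c"
  have "a \<subseteq>\<^sub>m a ++ b"
    using map_le_map_add[of a b] map_add_comm[OF assms] by simp
  then show "a \<subseteq>\<^sub>m c \<and> b \<subseteq>\<^sub>m c"
    using * map_le_map_add map_le_trans by blast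
qed (auto intro: map_add_le_mapI)

lemma holds_Sink: "label B u = Sink b \<Longrightarrow> holds B u \<alpha> \<longleftrightarrow> b"
  by (auto simp: holds_def accepts.simps[of B u])

lemma holds_Decision:
  assumes B: "is_wedge_d_fbdd B" and u: "u \<in> nodes B" and lab: "label B u = Decision x u0 u1"
  shows "holds B u \<alpha> \<longleftrightarrow> (if \<alpha> x then holds B u1 \<alpha> else holds B u0 \<alpha>)"
proof -
  have *: "a ++ [x \<mapsto> t] \<subseteq>\<^sub>m (Some \<circ> \<alpha>) \<longleftrightarrow> a \<subseteq>\<^sub>m (Some \<circ> \<alpha>) \<and> \<alpha> x = t"
    if "accepts B v a" "v \<in> {u0, u1}" for v a t
  proof -
    have "x \<notin> dom a"
      using dom_accepts[OF B that(1)] decision_not_below_child[OF B u lab that(2)]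
        nodes_closed[OF B u] that(2) lab by auto
    then show ?thesis
      by (subst map_add_le_iff) (auto simp: map_le_def)
  qed
  have acc: "accepts B u b \<longleftrightarrow>
      (\<exists>a. accepts B u0 a \<and> b = a ++ [x \<mapsto> False]) \<or> (\<exists>a. accepts B u1 a \<and> b = a ++ [x \<mapsto> True])" for b
    by (subst accepts.simps) (auto simp: lab)
  have "holds B u \<alpha> \<longleftrightarrow>
      (\<exists>a. accepts B u0 a \<and> a ++ [x \<mapsto> False] \<subseteq>\<^sub>m (Some \<circ> \<alpha>)) \<or>
      (\<exists>a. accepts B u1 a \<and> a ++ [x \<mapsto> True] \<subseteq>\<^sub>m (Some \<circ> \<alpha>))"
    unfolding holds_def acc by blast
  also have "\<dots> \<longleftrightarrow> (\<exists>a. accepts B u0 a \<and> a \<subseteq>\<^sub>m (Some \<circ> \<alpha>) \<and> \<not> \<alpha> x) \<or>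
      (\<exists>a. accepts B u1 a \<and> a \<subseteq>\<^sub>m (Some \<circ> \<alpha>) \<and> \<alpha> x)"
    using *[of u0 _ False] *[of u1 _ True] by (simp cong: conj_cong)
  finally show ?thesis
    by (auto simp: holds_def)
qed

text \<open>Decomposability makes the domains of the two accepted parts disjoint, so that
  \<open>++\<close> is a union and each part can be tested on its own.\<close>

lemma holds_Conjunction:
  assumes B: "is_wedge_d_fbdd B" and u: "u \<in> nodes B" and lab: "label B u = Conjunction u0 u1"
  shows "holds B u \<alpha> \<longleftrightarrow> holds B u0 \<alpha> \<and> holds B u1 \<alpha>"
proof -
  have disj: "dom a \<inter> dom b = {}" if "accepts B u0 a" "accepts B u1 b" for a b
  proof -
    have "u0 \<in> nodes B" "u1 \<in> nodes B"
      using nodes_closed[OF B u] lab by auto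
    then have "dom a \<subseteq> vars_below B u0" "dom b \<subseteq> vars_below B u1"
      using dom_accepts[OF B] that by auto
    moreover have "vars_below B u0 \<inter> vars_below B u1 = {}"
      using B u lab by (auto simp: is_wedge_d_fbdd_def decomposable_def)
    ultimately show ?thesis
      by blast
  qed
  have acc: "accepts B u c \<longleftrightarrow> (\<exists>a b. accepts B u0 a \<and> accepts B u1 b \<and> c = a ++ b)" for c
    by (subst accepts.simps) (auto simp: lab)
  have "holds B u \<alpha> \<longleftrightarrow>
      (\<exists>a b. accepts B u0 a \<and> accepts B u1 b \<and> a ++ b \<subseteq>\<^sub>m (Some \<circ> \<alpha>))"
    unfolding holds_def acc by blast
  also have "\<dots> \<longleftrightarrow> (\<exists>a b. accepts B u0 a \<and> accepts B u1 b \<and>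
      a \<subseteq>\<^sub>m (Some \<circ> \<alpha>) \<and> b \<subseteq>\<^sub>m (Some \<circ> \<alpha>))"
    using map_add_le_iff[OF disj] by blast
  finally show ?thesis
    by (auto simp: holds_def)
qed

lemma holds_cong:
  assumes "is_wedge_d_fbdd B" "u \<in> nodes B" "\<And>x. x \<in> vars_below B u \<Longrightarrow> \<alpha> x = \<beta> x"
  shows "holds B u \<alpha> \<longleftrightarrow> holds B u \<beta>"
proof -
  have "b \<subseteq>\<^sub>m (Some \<circ> \<alpha>) \<longleftrightarrow> b \<subseteq>\<^sub>m (Some \<circ> \<beta>)" if "accepts B u b" for b
    using dom_accepts[OF assms(1) that assms(2)] assms(3)
    unfolding map_le_def by (intro ball_cong[OF refl]) (simp add: subset_iff)
  then show ?thesis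
    by (auto simp: holds_def)
qed

lemma source_in_nodes: "is_wedge_d_fbdd B \<Longrightarrow> source B \<in> nodes B"
proof -
  assume "is_wedge_d_fbdd B"
  then have "\<exists>!s. is_source B s"
    by (simp add: is_wedge_d_fbdd_def)
  then have "is_source B (source B)"
    unfolding source_def by (rule theI')
  then show ?thesis
    by (simp add: is_source_def)
qed

definition cnf_holds :: "'v cnf \<Rightarrow> ('v \<Rightarrow> bool) \<Rightarrow> bool" where
  "cnf_holds \<phi> \<alpha> \<longleftrightarrow> (\<forall>C\<in>\<phi>. \<exists>(x, b)\<in>C. \<alpha> x = b)"

lemma represents_cnf_iff:
  fixes B :: "('n, 'v) bp"
  assumes B: "is_wedge_d_fbdd B"
  shows "represents B (cnf_function \<phi>) \<longleftrightarrow>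
    bp_vars B = cnf_vars \<phi> \<and> (\<forall>\<alpha>. holds B (source B) \<alpha> \<longleftrightarrow> cnf_holds \<phi> \<alpha>)"
proof -
  let ?r = "\<lambda>\<alpha> :: 'v \<Rightarrow> bool. (Some \<circ> \<alpha>) |` cnf_vars \<phi>"
  have total: "\<exists>\<alpha>. a = ?r \<alpha>" if "dom a = cnf_vars \<phi>" for a :: "'v assignment"
    unfolding that[symmetric]
    by (intro exI[of _ "the \<circ> a"]) (auto simp: fun_eq_iff restrict_map_def)
  have cnf: "(\<forall>C\<in>\<phi>. \<exists>(x, b)\<in>C. ?r \<alpha> x = Some b) \<longleftrightarrow> cnf_holds \<phi> \<alpha>" for \<alpha>
  proof -
    have "(\<exists>(x, b)\<in>C. ?r \<alpha> x = Some b) \<longleftrightarrow> (\<exists>(x, b)\<in>C. \<alpha> x = b)" if "C \<in> \<phi>" for C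
    proof (rule bex_cong[OF refl])
      fix l assume "l \<in> C"
      then have "fst l \<in> cnf_vars \<phi>"
        using that by (auto simp: cnf_vars_def)
      then show "(case l of (x, b) \<Rightarrow> ?r \<alpha> x = Some b) \<longleftrightarrow> (case l of (x, b) \<Rightarrow> \<alpha> x = b)"
        by (cases l) simp
    qed
    then show ?thesis
      unfolding cnf_holds_def by (rule ball_cong[OF refl])
  qed
  have holds: "(\<exists>b\<in>accepted B (source B). b \<subseteq>\<^sub>m ?r \<alpha>) \<longleftrightarrow> holds B (source B) \<alpha>"
    if "bp_vars B = cnf_vars \<phi>" for \<alpha>
  proof -
    have "b \<subseteq>\<^sub>m ?r \<alpha> \<longleftrightarrow> b \<subseteq>\<^sub>m (Some \<circ> \<alpha>)" if "accepts B (source B) b" for b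
    proof -
      have "dom b \<subseteq> cnf_vars \<phi>"
        using dom_accepts[OF B that source_in_nodes[OF B]] \<open>bp_vars B = cnf_vars \<phi>\<close>
        by (simp add: bp_vars_def)
      then show ?thesis
        unfolding map_le_def by (intro ball_cong[OF refl]) (simp add: subset_iff)
    qed
    then show ?thesis
      unfolding holds_def accepted_def by blast
  qed
  have all_total: "(\<forall>a. dom a = cnf_vars \<phi> \<longrightarrow> Q a) \<longleftrightarrow> (\<forall>\<alpha>. Q (?r \<alpha>))"
    for Q :: "'v assignment \<Rightarrow> bool"
  proof (intro iffI allI impI)
    fix a :: "'v assignment"
    assume "\<forall>\<alpha>. Q (?r \<alpha>)" "dom a = cnf_vars \<phi>"
    then show "Q a"
      using total[of a] by auto
  next
    fix \<alpha> assume "\<forall>a. dom a = cnf_vars \<phi> \<longrightarrow> Q a"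
    moreover have "dom (?r \<alpha>) = cnf_vars \<phi>"
      by (auto simp: restrict_map_def split: if_splits)
    ultimately show "Q (?r \<alpha>)"
      by blast
  qed
  have pair_eq: "(A, {a. P a \<and> Q a}) = (A, {a. P a \<and> R a}) \<longleftrightarrow> (\<forall>a. P a \<longrightarrow> (Q a \<longleftrightarrow> R a))"
    for A :: "'v set" and P Q R :: "'v assignment \<Rightarrow> bool"
    by auto
  show ?thesis
  proof (cases "bp_vars B = cnf_vars \<phi>")
    case True
    have "represents B (cnf_function \<phi>) \<longleftrightarrow>
      (\<forall>a. dom a = cnf_vars \<phi> \<longrightarrow> ((\<exists>b\<in>accepted B (source B). b \<subseteq>\<^sub>m a) \<longleftrightarrow>
        (\<forall>C\<in>\<phi>. \<exists>(x, b)\<in>C. a x = Some b)))"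
      unfolding represents_def bp_function_def cnf_function_def True by (rule pair_eq)
    also have "\<dots> \<longleftrightarrow> (\<forall>\<alpha>. (\<exists>b\<in>accepted B (source B). b \<subseteq>\<^sub>m ?r \<alpha>) \<longleftrightarrow>
        (\<forall>C\<in>\<phi>. \<exists>(x, b)\<in>C. ?r \<alpha> x = Some b))"
      by (rule all_total)
    also have "\<dots> \<longleftrightarrow> (\<forall>\<alpha>. holds B (source B) \<alpha> \<longleftrightarrow> cnf_holds \<phi> \<alpha>)"
      by (simp only: cnf holds[OF True])
    finally show ?thesis
      using True by simp
  next
    case False
    then show ?thesis
      by (simp add: represents_def bp_function_def cnf_function_def)
  qed
qed


section \<open>Cutting an OBDD\<close>

text \<open>The node \<open>v\<close> ends the path from \<open>u\<close> that follows
  \<open>\<alpha>\<close> as long as the labels lie in \<open>P\<close>. Without conjunctions this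
  is a single path, so one node records all that is known about the values on
  \<open>P\<close>.\<close>

lemma obdd_cut_node:
  assumes B: "is_obdd B"
    and order: "\<And>u v x y. (u, v) \<in> (edges B)\<^sup>+ \<Longrightarrow> decision_on B u x \<Longrightarrow> decision_on B v y \<Longrightarrow> (x, y) \<in> \<pi>"
    and down: "\<And>x y. (x, y) \<in> \<pi> \<Longrightarrow> y \<in> P \<Longrightarrow> x \<in> P"
    and u: "u \<in> nodes B"
  shows "\<exists>v\<in>nodes B. vars_below B v \<inter> P = {} \<and>
    (\<forall>\<gamma>. (\<forall>x\<in>P. \<gamma> x = \<alpha> x) \<longrightarrow> (holds B u \<gamma> \<longleftrightarrow> holds B v \<gamma>))"
proof -
  have fbdd: "is_wedge_d_fbdd B"
    using B by (simp add: is_obdd_def is_wedge_d_obdd_def)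
  have "finite (edges B)"
  proof (rule finite_subset)
    show "edges B \<subseteq> nodes B \<times> nodes B"
      using nodes_closed[OF fbdd] by (auto simp: edges_def)
    show "finite (nodes B \<times> nodes B)"
      using fbdd by (simp add: is_wedge_d_fbdd_def)
  qed
  then have "wf ((edges B)\<inverse>)"
    using fbdd by (intro finite_acyclic_wf_converse) (auto simp: is_wedge_d_fbdd_def)
  then show ?thesis
    using u
  proof (induction u rule: wf_induct_rule)
    case (less u)
    show ?case
    proof (cases "label B u")
      case (Sink b)
      have "vars_below B u = {}"
      proof -
        have "v = u" if "(u, v) \<in> (edges B)\<^sup>*" for v
          using that by (cases rule: converse_rtranclE) (auto simp: edges_def Sink)
        then show ?thesis
          using Sink by (fastforce simp: vars_below_def decision_on_def)
      qed
      then show ?thesis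
        using less.prems by auto
    next
      case (Conjunction u0 u1)
      then show ?thesis
        using B less.prems by (auto simp: is_obdd_def)
    next
      case (Decision x u0 u1)
      show ?thesis
      proof (cases "x \<in> P")
        case True
        define w where "w = (if \<alpha> x then u1 else u0)"
        have "(u, w) \<in> edges B" "w \<in> nodes B"
          using Decision less.prems nodes_closed[OF fbdd less.prems]
          by (auto simp: w_def intro!: child_edge)
        then obtain v where v: "v \<in> nodes B" "vars_below B v \<inter> P = {}"
          "\<forall>\<gamma>. (\<forall>x\<in>P. \<gamma> x = \<alpha> x) \<longrightarrow> (holds B w \<gamma> \<longleftrightarrow> holds B v \<gamma>)"
          using less.IH[of w] by blast
        moreover have "holds B u \<gamma> \<longleftrightarrow> holds B w \<gamma>" if "\<forall>x\<in>P. \<gamma> x = \<alpha> x" for \<gamma>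
          using holds_Decision[OF fbdd less.prems Decision, of \<gamma>] that True by (simp add: w_def)
        ultimately show ?thesis
          by (intro bexI[of _ v]) auto
      next
        case False
        \<comment> \<open>A label in \<open>P\<close> below a node labelled \<open>x\<close> would
          put \<open>x\<close> into the downward closed set \<open>P\<close>.\<close>
        have "y \<notin> P" if y: "y \<in> vars_below B u" for y
        proof
          assume "y \<in> P"
          obtain v where v: "(u, v) \<in> (edges B)\<^sup>*" "decision_on B v y"
            using y by (auto simp: vars_below_def)
          have x: "decision_on B u x"
            using Decision less.prems by (auto simp: decision_on_def)
          show False
          proof (cases "u = v")
            case True
            then show False
              using v(2) Decision \<open>y \<in> P\<close> False by (auto simp: decision_on_def)
          next
            case ne: False
            then have "(u, v) \<in> (edges B)\<^sup>+"
              using v(1) by (simp add: rtrancl_eq_or_trancl)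
            then show False
              using order[OF _ x v(2)] down \<open>y \<in> P\<close> False by blast
          qed
        qed
        then show ?thesis
          using less.prems by blast
      qed
    qed
  qed
qed

text \<open>Indices with the same cut node can exchange their assignments on \<open>P\<close>.\<close>

lemma obdd_size_fooling:
  fixes \<delta> :: "'i \<Rightarrow> 'v \<Rightarrow> bool"
  assumes B: "is_obdd B"
    and order: "\<And>u v x y. (u, v) \<in> (edges B)\<^sup>+ \<Longrightarrow> decision_on B u x \<Longrightarrow> decision_on B v y \<Longrightarrow> (x, y) \<in> \<pi>"
    and down: "\<And>x y. (x, y) \<in> \<pi> \<Longrightarrow> y \<in> P \<Longrightarrow> x \<in> P"
    and sat: "\<And>i. i \<in> I \<Longrightarrow> holds B (source B) (\<delta> i)"
    and cross: "\<And>i j. i \<in> I \<Longrightarrow> j \<in> I \<Longrightarrow>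
      holds B (source B) (\<lambda>x. if x \<in> P then \<delta> i x else \<delta> j x) \<Longrightarrow>
      holds B (source B) (\<lambda>x. if x \<in> P then \<delta> j x else \<delta> i x) \<Longrightarrow> i = j"
  shows "card I \<le> bp_size B"
proof -
  have fbdd: "is_wedge_d_fbdd B"
    using B by (simp add: is_obdd_def is_wedge_d_obdd_def)
  let ?cut = "\<lambda>i v. v \<in> nodes B \<and> vars_below B v \<inter> P = {} \<and>
    (\<forall>\<gamma>. (\<forall>x\<in>P. \<gamma> x = \<delta> i x) \<longrightarrow> (holds B (source B) \<gamma> \<longleftrightarrow> holds B v \<gamma>))"
  have "\<forall>i. \<exists>v. ?cut i v"
  proof
    fix i
    have "\<exists>v\<in>nodes B. vars_below B v \<inter> P = {} \<and>
      (\<forall>\<gamma>. (\<forall>x\<in>P. \<gamma> x = \<delta> i x) \<longrightarrow> (holds B (source B) \<gamma> \<longleftrightarrow> holds B v \<gamma>))"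
      using order down source_in_nodes[OF fbdd] by (rule obdd_cut_node[OF B])
    then show "\<exists>v. ?cut i v"
      unfolding Bex_def .
  qed
  then obtain cut where "\<forall>i. ?cut i (cut i)"
    by (rule choice[THEN exE])
  then have cut: "\<And>i. cut i \<in> nodes B" "\<And>i. vars_below B (cut i) \<inter> P = {}"
    and holds_cut: "\<And>\<gamma> i. \<forall>x\<in>P. \<gamma> x = \<delta> i x \<Longrightarrow>
      holds B (source B) \<gamma> \<longleftrightarrow> holds B (cut i) \<gamma>"
    by simp_all
  \<comment> \<open>On \<open>P\<close> the mixture agrees with \<open>\<delta> i\<close> and so is
    decided at \<open>cut i = cut j\<close>; no variable of \<open>P\<close> is read from there on,
    so the answer is that for \<open>\<delta> j\<close>.\<close>
  have mixed: "holds B (source B) (\<lambda>x. if x \<in> P then \<delta> i x else \<delta> j x)"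
    if "j \<in> I" "cut i = cut j" for i j
  proof -
    have "holds B (cut j) (\<delta> j)"
      using sat[OF that(1)] holds_cut[of "\<delta> j" j] by simp
    moreover have "holds B (cut i) (\<lambda>x. if x \<in> P then \<delta> i x else \<delta> j x) \<longleftrightarrow> holds B (cut i) (\<delta> j)"
      using cut(2)[of i] by (intro holds_cong[OF fbdd cut(1)]) auto
    ultimately have "holds B (cut i) (\<lambda>x. if x \<in> P then \<delta> i x else \<delta> j x)"
      using that(2) by simp
    then show ?thesis
      by (subst holds_cut[of _ i]) auto
  qed
  have "inj_on cut I"
    using cross mixed by (intro inj_onI) simp
  moreover have "cut ` I \<subseteq> nodes B" "finite (nodes B)"
    using cut fbdd by (auto simp: is_wedge_d_fbdd_def)
  ultimately show ?thesis
    unfolding bp_size_def by (rule card_inj_on_le)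
qed

text \<open>Only elements of \<open>X\<close> are counted, since the order may place other elements
  of \<open>V\<close> between them. Each induction step adds the least element of
  \<open>X - D\<close>.\<close>

lemma linear_order_initial_segment:
  assumes lin: "linear_order_on V \<pi>" and X: "finite X" "X \<subseteq> V" and k: "k \<le> card X"
  shows "\<exists>D\<subseteq>X. card D = k \<and> (\<forall>x\<in>X. \<forall>y\<in>D. (x, y) \<in> \<pi> \<longrightarrow> x \<in> D)"
  using k
proof (induction k)
  case 0
  then show ?case
    by (intro exI[of _ "{}"]) auto
next
  case (Suc k)
  then obtain D where D: "D \<subseteq> X" "card D = k" "\<forall>x\<in>X. \<forall>y\<in>D. (x, y) \<in> \<pi> \<longrightarrow> x \<in> D"
    by auto
  have refl: "(x, x) \<in> \<pi>" if "x \<in> V" for x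
    using lin that by (auto simp: order_on_defs refl_on_def)
  have tot: "(x, y) \<in> \<pi> \<or> (y, x) \<in> \<pi>" if "x \<in> V" "y \<in> V" for x y
    using lin that refl by (cases "x = y") (auto simp: order_on_defs total_on_def)
  have tr: "trans \<pi>" and anti: "antisym \<pi>"
    using lin by (auto simp: order_on_defs)
  have least: "\<exists>m\<in>Y. \<forall>y\<in>Y. (m, y) \<in> \<pi>" if "finite Y" "Y \<noteq> {}" "Y \<subseteq> V" for Y
    using that
  proof (induction Y rule: finite_ne_induct)
    case (singleton x)
    then show ?case using refl by auto
  next
    case (insert x Y)
    then obtain m where m: "m \<in> Y" "\<forall>y\<in>Y. (m, y) \<in> \<pi>" by auto
    have "m \<in> V" "x \<in> V"
      using m(1) insert.prems by auto
    then show ?case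
      using tot[of x m] m refl transD[OF tr, of x m] by auto
  qed
  have "D \<noteq> X"
    using Suc.prems D(2) by auto
  then obtain m where m: "m \<in> X - D" "\<forall>y\<in>X - D. (m, y) \<in> \<pi>"
    using least[of "X - D"] X D(1) by blast
  have "finite D"
    using D(1) X(1) finite_subset by blast
  then have "card (insert m D) = Suc k"
    using m D(2) by simp
  moreover have "\<forall>x\<in>X. \<forall>y\<in>insert m D. (x, y) \<in> \<pi> \<longrightarrow> x \<in> insert m D"
    using m D(3) antisymD[OF anti] by blast
  ultimately show ?case
    using m D(1) by (intro exI[of _ "insert m D"]) auto
qed


section \<open>Selected matchings\<close>

text \<open>Variable \<open>c < 2 * N\<close> selects the matching of all pairs with sum \<open>c\<close>;
  variable \<open>2 * N + i\<close> is the vertex \<open>i < N\<close>.\<close>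

definition matching_cnf :: "nat \<Rightarrow> nat cnf" where
  "matching_cnf N =
     (\<lambda>(c, d). {(c, False), (d, False)}) ` {(c, d). c < d \<and> d < 2 * N} \<union>
     (\<lambda>(i, j). {(i + j, False), (2 * N + i, True), (2 * N + j, True)}) ` {(i, j). i < j \<and> j < N}"

definition matched :: "nat \<Rightarrow> (nat \<Rightarrow> bool) \<Rightarrow> nat \<Rightarrow> bool" where
  "matched N \<alpha> c \<longleftrightarrow> (\<forall>i j. i < j \<and> j < N \<and> i + j = c \<longrightarrow> \<alpha> (2 * N + i) \<or> \<alpha> (2 * N + j))"

lemma is_cnf_matching_cnf: "is_cnf (matching_cnf N)"
proof -
  have "finite {(c, d). c < d \<and> d < (k::nat)}" for k
    by (rule finite_subset[of _ "{..<k} \<times> {..<k}"]) auto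
  then show ?thesis
    unfolding is_cnf_def matching_cnf_def by auto
qed

text \<open>Every other vertex is paired with vertex 0, and vertex 0 with vertex 1, which exists
  because \<open>2 \<le> N\<close>.\<close>

lemma cnf_vars_matching_cnf:
  assumes "2 \<le> N"
  shows "cnf_vars (matching_cnf N) = {..<3 * N}"
proof
  show "cnf_vars (matching_cnf N) \<subseteq> {..<3 * N}"
    by (auto simp: cnf_vars_def matching_cnf_def)
  have vars: "cnf_vars (matching_cnf N) =
      (\<Union>(c, d)\<in>{(c, d). c < d \<and> d < 2 * N}. {c, d}) \<union>
      (\<Union>(i, j)\<in>{(i, j). i < j \<and> j < N}. {i + j, 2 * N + i, 2 * N + j})"
    unfolding cnf_vars_def matching_cnf_def UN_Un image_image UN_simps
    by (simp add: case_prod_unfold)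
  have sel: "c \<in> cnf_vars (matching_cnf N)" "d \<in> cnf_vars (matching_cnf N)"
    if "c < d" "d < 2 * N" for c d
    unfolding vars using that by blast+
  have ver: "2 * N + i \<in> cnf_vars (matching_cnf N)" "2 * N + j \<in> cnf_vars (matching_cnf N)"
    if "i < j" "j < N" for i j
    unfolding vars using that by blast+
  show "{..<3 * N} \<subseteq> cnf_vars (matching_cnf N)"
  proof
    fix v assume "v \<in> {..<3 * N}"
    then consider "v = 0" | "0 < v" "v < 2 * N" | "v = 2 * N"
      | "2 * N < v" "v < 3 * N"
      by force
    then show "v \<in> cnf_vars (matching_cnf N)"
    proof cases
      case 4
      then show ?thesis
        using ver(2)[of 0 "v - 2 * N"] by force
    qed (use assms sel(1)[of 0 1] sel(2)[of 0 v] ver(1)[of 0 1] in auto)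
  qed
qed

lemma cnf_holds_matching_cnf:
  "cnf_holds (matching_cnf N) \<alpha> \<longleftrightarrow>
    (\<forall>c d. c < d \<and> d < 2 * N \<longrightarrow> \<not> (\<alpha> c \<and> \<alpha> d)) \<and> (\<forall>c<2 * N. \<alpha> c \<longrightarrow> matched N \<alpha> c)"
proof -
  have "cnf_holds (matching_cnf N) \<alpha> \<longleftrightarrow>
    (\<forall>c d. c < d \<and> d < 2 * N \<longrightarrow> \<not> (\<alpha> c \<and> \<alpha> d)) \<and>
    (\<forall>i j. i < j \<and> j < N \<and> \<alpha> (i + j) \<longrightarrow> \<alpha> (2 * N + i) \<or> \<alpha> (2 * N + j))"
    unfolding cnf_holds_def matching_cnf_def ball_Un by simp blast
  also have "(\<forall>i j. i < j \<and> j < N \<and> \<alpha> (i + j) \<longrightarrow> \<alpha> (2 * N + i) \<or> \<alpha> (2 * N + j)) \<longleftrightarrow>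
    (\<forall>c<2 * N. \<alpha> c \<longrightarrow> matched N \<alpha> c)"
  proof (intro iffI allI impI)
    fix i j
    assume *: "\<forall>c<2 * N. \<alpha> c \<longrightarrow> matched N \<alpha> c" "i < j \<and> j < N \<and> \<alpha> (i + j)"
    then have "matched N \<alpha> (i + j)"
      by simp
    then show "\<alpha> (2 * N + i) \<or> \<alpha> (2 * N + j)"
      using *(2) by (auto simp: matched_def)
  qed (auto simp: matched_def)
  finally show ?thesis .
qed

text \<open>Averaging: the \<open>m * m\<close> pairs between \<open>D\<close> and its complement
  are distributed over \<open>4 * m\<close> sums. For a fixed sum \<open>c\<close> the end
  \<open>l\<close> in \<open>D\<close> determines the other end \<open>c - l\<close>, so counting
  left ends counts pairs; \<open>l \<le> c\<close> guards the truncated subtraction.\<close>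

lemma many_crossing_pairs:
  assumes D: "D \<subseteq> {..<2 * m}" "card D = m" and m: "0 < m"
  shows "\<exists>c<4 * m. m \<le> 4 * card {l \<in> D. l \<le> c \<and> c - l < 2 * m \<and> c - l \<notin> D}"
proof (rule ccontr)
  define R where "R = {..<2 * m} - D"
  define K where "K c = {l \<in> D. l \<le> c \<and> c - l < 2 * m \<and> c - l \<notin> D}" for c
  assume "\<not> ?thesis"
  then have small: "4 * card (K c) < m" if "c < 4 * m" for c
    using that by (auto simp: K_def not_le)
  have fin: "finite D"
    using D(1) finite_subset by blast
  then have finK: "finite (K c)" for c
    by (simp add: K_def)
  have "D \<times> R \<subseteq> (\<Union>c<4 * m. (\<lambda>l. (l, c - l)) ` K c)"
  proof (clarify)
    fix l r assume lr: "l \<in> D" "r \<in> R"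
    then have "l \<in> K (l + r)" "l + r < 4 * m" "(l, r) = (l, (l + r) - l)"
      using D(1) by (auto simp: K_def R_def)
    then show "(l, r) \<in> (\<Union>c<4 * m. (\<lambda>l. (l, c - l)) ` K c)"
      by blast
  qed
  moreover have "finite (\<Union>c<4 * m. (\<lambda>l. (l, c - l)) ` K c)"
    using finK by simp
  ultimately have "card (D \<times> R) \<le> card (\<Union>c<4 * m. (\<lambda>l. (l, c - l)) ` K c)"
    by (intro card_mono)
  also have "\<dots> \<le> (\<Sum>c<4 * m. card ((\<lambda>l. (l, c - l)) ` K c))"
    by (rule card_UN_le) simp
  also have "\<dots> \<le> (\<Sum>c<4 * m. card (K c))"
    using finK by (intro sum_mono card_image_le)
  finally have "4 * card (D \<times> R) \<le> (\<Sum>c<4 * m. 4 * card (K c))"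
    by (simp add: sum_distrib_left[symmetric])
  also have "\<dots> < (\<Sum>c<4 * m. m)"
    using m small by (intro sum_strict_mono) (auto simp: lessThan_empty_iff)
  finally have "4 * card (D \<times> R) < 4 * (m * m)"
    by simp
  moreover have "card R = m"
    using D fin by (simp add: R_def card_Diff_subset)
  ultimately show False
    using D(2) by (simp add: card_cartesian_product)
qed

text \<open>The exponent \<open>k\<close> is the number of pairs of the chosen matching that the cut
  splits; every subset of their ends in \<open>D\<close> gives one member of a fooling set.\<close>

lemma matching_obdd_size:
  assumes m: "0 < m" and B: "is_obdd B"
    and rep: "represents B (cnf_function (matching_cnf (2 * m)))"
  shows "\<exists>k. m \<le> 4 * k \<and> 2 ^ k \<le> bp_size B"
proof -
  define N where "N = 2 * m"
  have fbdd: "is_wedge_d_fbdd B"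
    using B by (simp add: is_obdd_def is_wedge_d_obdd_def)
  have vars: "bp_vars B = {..<3 * N}"
    and holds: "\<And>\<alpha>. holds B (source B) \<alpha> \<longleftrightarrow> cnf_holds (matching_cnf N) \<alpha>"
    using rep m by (simp_all add: represents_cnf_iff[OF fbdd] cnf_vars_matching_cnf N_def)
  obtain V \<pi> where lin: "linear_order_on V \<pi>" and V: "bp_vars B \<subseteq> V"
    and order: "\<And>u v x y. (u, v) \<in> (edges B)\<^sup>+ \<Longrightarrow> decision_on B u x \<Longrightarrow> decision_on B v y \<Longrightarrow> (x, y) \<in> \<pi>"
    using B unfolding is_obdd_def is_wedge_d_obdd_def by blast
  have refl: "(x, x) \<in> \<pi>" if "x \<in> V" for x
    using lin that by (auto simp: order_on_defs refl_on_def)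
  have tr: "trans \<pi>"
    using lin by (simp add: order_on_defs)
  let ?X = "(+) (2 * N) ` {..<N}"
  have X: "?X \<subseteq> V" "card ?X = N"
    using V vars by (auto simp: card_image)
  obtain E where E: "E \<subseteq> ?X" "card E = m" "\<forall>x\<in>?X. \<forall>y\<in>E. (x, y) \<in> \<pi> \<longrightarrow> x \<in> E"
    using linear_order_initial_segment[OF lin _ X(1), of m] X(2) N_def by auto
  \<comment> \<open>The closure is taken in all of \<open>\<pi>\<close>, so \<open>P\<close> may
    also contain selectors; among the vertex variables it is exactly \<open>E\<close>.\<close>
  define P where "P = {x. \<exists>y\<in>E. (x, y) \<in> \<pi>}"
  have down: "x \<in> P" if "(x, y) \<in> \<pi>" "y \<in> P" for x y
    using that transD[OF tr] unfolding P_def by blast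
  have P_E: "x \<in> P \<longleftrightarrow> x \<in> E" if "x \<in> ?X" for x
    using E refl X(1) that unfolding P_def by blast
  define D where "D = {l. l < N \<and> 2 * N + l \<in> P}"
  have ED: "E = (+) (2 * N) ` D"
    using E(1) P_E unfolding D_def by auto
  have D: "D \<subseteq> {..<2 * m}" "card D = m"
    using E(2) unfolding ED by (auto simp: card_image D_def N_def)
  obtain c where c: "c < 4 * m"
    and cK: "m \<le> 4 * card {l \<in> D. l \<le> c \<and> c - l < 2 * m \<and> c - l \<notin> D}"
    using many_crossing_pairs[OF D m] by blast
  define K where "K = {l \<in> D. l \<le> c \<and> c - l < N \<and> c - l \<notin> D}"
  have finK: "finite K"
    using D(1) finite_subset[of K "{..<2 * m}"] by (auto simp: K_def)
  \<comment> \<open>Select the matching \<open>c\<close>; the left end of a pair in \<open>K\<close> is true iff it belongs to \<open>A\<close>,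
    the right end is the negation, and all other vertices are true.\<close>
  define \<delta> where "\<delta> A v = (if v < 2 * N then v = c
      else if v - 2 * N \<in> D then v - 2 * N \<in> K \<longrightarrow> v - 2 * N \<in> A
      else \<not> (v - 2 * N \<le> c \<and> c - (v - 2 * N) \<in> A))" for A v
  \<comment> \<open>The mixture takes left ends from \<open>A\<close> and right ends from
    \<open>A'\<close>, so the clause of the pair at \<open>l\<close> says that \<open>l\<close> is
    in \<open>A\<close> or not in \<open>A'\<close>. All \<open>\<delta> A\<close> agree on the
    selectors, so it does not matter on which side of the cut these lie.\<close>
  have mix: "holds B (source B) (\<lambda>x. if x \<in> P then \<delta> A x else \<delta> A' x) \<longleftrightarrow> A' \<subseteq> A"
    if A: "A \<subseteq> K" "A' \<subseteq> K" for A A'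
  proof -
    let ?\<gamma> = "\<lambda>x. if x \<in> P then \<delta> A x else \<delta> A' x"
    have sel: "?\<gamma> d \<longleftrightarrow> d = c" if "d < 2 * N" for d
      using that by (simp add: \<delta>_def)
    have left: "?\<gamma> (2 * N + l) \<longleftrightarrow> (l \<in> K \<longrightarrow> l \<in> A)" if "l \<in> D" for l
      using that by (simp add: \<delta>_def D_def)
    have right: "?\<gamma> (2 * N + r) \<longleftrightarrow> \<not> (r \<le> c \<and> c - r \<in> A')" if "r < N" "r \<notin> D" for r
      using that by (simp add: \<delta>_def D_def)
    have "cnf_holds (matching_cnf N) ?\<gamma> \<longleftrightarrow> matched N ?\<gamma> c"
      unfolding cnf_holds_matching_cnf using sel c by (auto simp: N_def)
    also have "\<dots> \<longleftrightarrow> A' \<subseteq> A"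
    proof
      assume matched: "matched N ?\<gamma> c"
      show "A' \<subseteq> A"
      proof
        fix l assume l: "l \<in> A'"
        then have lK: "l \<in> D" "l \<le> c" "c - l < N" "c - l \<notin> D" "l \<in> K"
          using A by (auto simp: K_def)
        then have "\<not> ?\<gamma> (2 * N + (c - l))"
          using right[of "c - l"] l by simp
        moreover have "?\<gamma> (2 * N + l) \<or> ?\<gamma> (2 * N + (c - l))"
        \<comment> \<open>\<open>matched\<close> orders a pair by size, while left and right refer
          to the cut, so both orientations occur. The ends differ because only one of them lies in
          \<open>D\<close>.\<close>
        proof (cases "l < c - l")
          case True
          then show ?thesis
            using matched lK unfolding matched_def by (metis le_add_diff_inverse)
        next
          case False
          then have "c - l < l"
            using lK by (metis linorder_neqE_nat)
          then show ?thesis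
            using matched lK unfolding matched_def D_def
            by (metis (no_types, lifting) le_add_diff_inverse2 mem_Collect_eq)
        qed
        ultimately show "l \<in> A"
          using left lK by blast
      qed
    next
      assume AA: "A' \<subseteq> A"
      have pair: "?\<gamma> (2 * N + l) \<or> ?\<gamma> (2 * N + r)"
        if "l \<in> D" "r \<notin> D" "r < N" "l + r = c" for l r
        using left[OF that(1)] right[OF that(3,2)] AA that by auto
      \<comment> \<open>A pair that does not cross the cut is covered by the default value true: an
        element of \<open>K\<close> has its partner outside \<open>D\<close>.\<close>
      have pair_l: "?\<gamma> (2 * N + l) \<or> ?\<gamma> (2 * N + r)"
        if "l \<in> D" "r \<in> D" "l + r = c" for l r
        using left[OF that(1)] that by (auto simp: K_def)
      have pair_r: "?\<gamma> (2 * N + l) \<or> ?\<gamma> (2 * N + r)"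
        if "l \<notin> D" "r \<notin> D" "l < N" "l + r = c" for l r
        using right[OF that(3,1)] that A by (auto simp: K_def)
      show "matched N ?\<gamma> c"
        unfolding matched_def
      proof (intro allI impI)
        fix i j assume "i < j \<and> j < N \<and> i + j = c"
        then have ij: "i < N" "j < N" "i + j = c" "j + i = c"
          by auto
        then show "?\<gamma> (2 * N + i) \<or> ?\<gamma> (2 * N + j)"
          using pair[of i j] pair[of j i] pair_l[of i j] pair_r[of i j] by blast
      qed
    qed
    finally show ?thesis
      by (simp add: holds)
  qed
  have "card (Pow K) \<le> bp_size B"
  proof (rule obdd_size_fooling[OF B])
    show "(x, y) \<in> \<pi>" if "(u, v) \<in> (edges B)\<^sup>+" "decision_on B u x" "decision_on B v y" for u v x y
      using that by (rule order)
    show "x \<in> P" if "(x, y) \<in> \<pi>" "y \<in> P" for x y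
      using that by (rule down)
    show "holds B (source B) (\<delta> A)" if "A \<in> Pow K" for A
      using mix[of A A] that by simp
    show "A = A'" if "A \<in> Pow K" "A' \<in> Pow K"
      and "holds B (source B) (\<lambda>x. if x \<in> P then \<delta> A x else \<delta> A' x)"
      and "holds B (source B) (\<lambda>x. if x \<in> P then \<delta> A' x else \<delta> A x)" for A A'
      using that mix[of A A'] mix[of A' A] by auto
  qed
  then show ?thesis
    using cK finK by (intro exI[of _ "card K"]) (simp add: card_Pow K_def N_def)
qed


section \<open>Branching programs from labelled graphs\<close>

text \<open>\<open>rank\<close> witnesses acyclicity, and \<open>scope x\<close> is an upper bound for the variables
  below \<open>x\<close>. The injection \<open>e\<close> renames the nodes.\<close>

locale layout =
  fixes e :: "'a \<Rightarrow> 'n"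
    and lab :: "'a \<Rightarrow> ('a, 'v :: linorder) node_label"
    and root :: 'a
    and U :: "'a set"
    and rank :: "'a \<Rightarrow> nat"
    and scope :: "'a \<Rightarrow> 'v set"
  assumes inj_e: "inj e"
    and finite_U: "finite U"
    and root_U: "root \<in> U"
    and U_closed: "x \<in> U \<Longrightarrow> y \<in> children (lab x) \<Longrightarrow> y \<in> U"
    and rank_child: "x \<in> U \<Longrightarrow> y \<in> children (lab x) \<Longrightarrow> rank y < rank x"
    and scope_child: "x \<in> U \<Longrightarrow> y \<in> children (lab x) \<Longrightarrow> scope y \<subseteq> scope x"
    and scope_decision: "x \<in> U \<Longrightarrow> lab x = Decision v a b \<Longrightarrow> v \<in> scope x"
    and scope_less: "x \<in> U \<Longrightarrow> lab x = Decision v a b \<Longrightarrow> w \<in> scope a \<union> scope b \<Longrightarrow> v < w"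
    and scope_disjoint: "x \<in> U \<Longrightarrow> lab x = Conjunction a b \<Longrightarrow> scope a \<inter> scope b = {}"
    and sink_unique: "x \<in> U \<Longrightarrow> y \<in> U \<Longrightarrow> lab x = Sink t \<Longrightarrow> lab y = Sink t \<Longrightarrow> x = y"
begin

text \<open>\<open>U\<close> may contain nodes that the root does not reach, and these could be
  further sources. Restricting to \<open>reach\<close> leaves the root as the only one.\<close>

inductive_set reach :: "'a set" where
  reach_root: "root \<in> reach"
| reach_child: "x \<in> reach \<Longrightarrow> y \<in> children (lab x) \<Longrightarrow> y \<in> reach"

definition program :: "('n, 'v) bp" where
  "program = \<lparr>nodes = e ` reach, label = (\<lambda>n. map_node_label e id (lab (inv e n)))\<rparr>"

lemma reach_U: "x \<in> reach \<Longrightarrow> x \<in> U"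
  by (induction rule: reach.induct) (auto intro: root_U U_closed)

lemma nodes_program: "nodes program = e ` reach"
  by (simp add: program_def)

lemma label_program: "label program (e x) = map_node_label e id (lab x)"
  by (simp add: program_def inv_f_f[OF inj_e])

lemma children_label: "children (label program (e x)) = e ` children (lab x)"
  unfolding label_program by (cases "lab x") auto

lemma edges_program: "(u, w) \<in> edges program \<longleftrightarrow>
    (\<exists>x y. u = e x \<and> w = e y \<and> x \<in> reach \<and> y \<in> children (lab x))"
  unfolding edges_def nodes_program by (auto simp: children_label) blast

lemma decision_on_program:
  "decision_on program (e x) v \<longleftrightarrow> x \<in> reach \<and> (\<exists>a b. lab x = Decision v a b)"
  unfolding decision_on_def label_program nodes_program
  by (cases "lab x") (auto simp: inj_image_mem_iff[OF inj_e])

lemma edges_rtrancl: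
  assumes "(u, w) \<in> (edges program)\<^sup>*" "u = e x" "x \<in> reach"
  shows "\<exists>y\<in>reach. w = e y \<and> scope y \<subseteq> scope x"
  using assms
proof (induction rule: rtrancl_induct)
  case (step w w')
  then obtain y where y: "y \<in> reach" "w = e y" "scope y \<subseteq> scope x"
    by auto
  then obtain z where "w' = e z" "z \<in> children (lab y)"
    using step.hyps(2) by (auto simp: edges_program inj_eq[OF inj_e])
  then show ?case
    using y reach_child scope_child[OF reach_U[OF y(1)]] by blast
qed auto

lemma vars_below_program:
  assumes "x \<in> reach"
  shows "vars_below program (e x) \<subseteq> scope x"
proof
  fix v assume "v \<in> vars_below program (e x)"
  then obtain w where w: "(e x, w) \<in> (edges program)\<^sup>*" "decision_on program w v"
    by (auto simp: vars_below_def)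
  then obtain y where y: "y \<in> reach" "w = e y" "scope y \<subseteq> scope x"
    using edges_rtrancl[OF w(1) HOL.refl assms] by blast
  then show "v \<in> scope x"
    using w(2) scope_decision[OF reach_U] by (auto simp: decision_on_program)
qed

text \<open>\<open>scope_less\<close> handles the first edge, and scopes only shrink afterwards. The
  strict inequality yields read-once and the order condition at once, with the given order of the
  variables as \<open>\<pi>\<close>.\<close>

lemma decision_less:
  assumes "(u, w) \<in> (edges program)\<^sup>+" "decision_on program u v" "decision_on program w v'"
  shows "v < v'"
proof -
  obtain u' where u': "(u, u') \<in> edges program" "(u', w) \<in> (edges program)\<^sup>*"
    using assms(1) by (meson tranclD)
  then obtain x y where xy: "u = e x" "u' = e y" "x \<in> reach" "y \<in> children (lab x)"
    by (auto simp: edges_program)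
  then obtain a b where lab: "lab x = Decision v a b"
    using assms(2) by (auto simp: decision_on_program)
  have "v' \<in> vars_below program u'"
    using u'(2) assms(3) by (auto simp: vars_below_def)
  then have "v' \<in> scope y"
    using vars_below_program[OF reach_child[OF xy(3,4)]] xy(2) by auto
  then show ?thesis
    using scope_less[OF reach_U[OF xy(3)] lab] xy(4) lab by auto
qed

lemma acyclic_program: "acyclic (edges program)"
proof -
  have "rank (inv e w) < rank (inv e u)" if "(u, w) \<in> (edges program)\<^sup>+" for u w
    using that
  proof (induction rule: trancl_induct)
    case (base w)
    then show ?case
      using rank_child[OF reach_U] by (auto simp: edges_program inv_f_f[OF inj_e])
  next
    case (step w w')
    then have "rank (inv e w') < rank (inv e w)"
      using rank_child[OF reach_U] by (auto simp: edges_program inv_f_f[OF inj_e])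
    then show ?case
      using step.IH by simp
  qed
  then show ?thesis
    by (intro acyclicI) blast
qed

text \<open>No edge returns to the root, whose rank is the largest on \<open>reach\<close>; every
  other reachable node was reached through an edge.\<close>

lemma is_source_program: "is_source program s \<longleftrightarrow> s = e root"
proof
  assume "is_source program s"
  then obtain x where x: "s = e x" "x \<in> reach" "e x \<notin> Range (edges program)"
    by (auto simp: is_source_def nodes_program)
  from x(2) show "s = e root"
  proof cases
    case (reach_child y)
    then have "(e y, e x) \<in> edges program"
      by (auto simp: edges_program)
    then show ?thesis
      using x(3) by blast
  qed (use x in simp)
next
  have rank: "rank x \<le> rank root" if "x \<in> reach" for x
    using that
  proof (induction rule: reach.induct)
    case (reach_child x y)
    then show ?case
      using rank_child[OF reach_U, of x y] by simp
  qed simp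
  assume s: "s = e root"
  have "e root \<notin> Range (edges program)"
  proof
    assume "e root \<in> Range (edges program)"
    then obtain x where "x \<in> reach" "root \<in> children (lab x)"
      by (auto simp: edges_program inj_eq[OF inj_e])
    then show False
      using rank[of x] rank_child[OF reach_U, of x root] by simp
  qed
  then show "is_source program s"
    using s by (simp add: is_source_def nodes_program reach_root)
qed

lemma source_program: "source program = e root"
  unfolding source_def is_source_program by simp

lemma program_fbdd: "is_wedge_d_fbdd program"
  unfolding is_wedge_d_fbdd_def
proof (intro conjI)
  show "finite (nodes program)"
    using finite_subset[OF _ finite_U, of reach] reach_U by (auto simp: nodes_program)
  show "\<forall>u\<in>nodes program. children (label program u) \<subseteq> nodes program"
    using reach_child by (auto simp: nodes_program children_label)
  show "acyclic (edges program)"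
    by (rule acyclic_program)
  show "\<exists>!s. is_source program s"
    by (simp add: is_source_program)
  have "lab x = Sink b" if "label program (e x) = Sink b" for x b
    using that unfolding label_program by (cases "lab x") auto
  then have "x = y" if "x \<in> reach" "y \<in> reach"
    "label program (e x) = Sink b" "label program (e y) = Sink b" for x y b
    using sink_unique[OF reach_U reach_U] that by blast
  then show "\<forall>u\<in>nodes program. \<forall>v\<in>nodes program. \<forall>b.
      label program u = Sink b \<and> label program v = Sink b \<longrightarrow> u = v"
    by (auto simp: nodes_program inj_eq[OF inj_e])
  show "decomposable program"
    unfolding decomposable_def
  proof (intro ballI allI impI)
    fix u u0 u1
    assume "u \<in> nodes program" and lab: "label program u = Conjunction u0 u1"
    then obtain x where x: "u = e x" "x \<in> reach"
      by (auto simp: nodes_program)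
    then obtain a b where ab: "lab x = Conjunction a b" "u0 = e a" "u1 = e b"
      using lab by (cases "lab x") (auto simp: label_program)
    then show "vars_below program u0 \<inter> vars_below program u1 = {}"
      using vars_below_program[OF reach_child[OF x(2), of a]]
        vars_below_program[OF reach_child[OF x(2), of b]]
        scope_disjoint[OF reach_U[OF x(2)] ab(1)] by auto
  qed
  show "read_once program"
    unfolding read_once_def using decision_less by blast
qed

lemma program_obdd: "is_wedge_d_obdd program"
  unfolding is_wedge_d_obdd_def
proof (intro conjI exI)
  show "linear_order_on UNIV {(x :: 'v, y). x \<le> y}"
    by (auto simp: order_on_defs refl_on_def trans_def antisym_def total_on_def)
  show "\<forall>u v x y. (u, v) \<in> (edges program)\<^sup>+ \<and> decision_on program u x \<and> decision_on program v y \<longrightarrow>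
      (x, y) \<in> {(x, y). x \<le> y} \<and> x \<noteq> y"
    using decision_less by fastforce
qed (simp_all add: program_fbdd)

lemma bp_size_program: "bp_size program \<le> card U"
proof -
  have "card reach \<le> card U"
    using reach_U by (intro card_mono finite_U) auto
  then show ?thesis
    using inj_e by (simp add: bp_size_def nodes_program card_image inj_on_subset[OF inj_e subset_UNIV])
qed

lemma bp_vars_program: "bp_vars program = {v. \<exists>x\<in>reach. \<exists>a b. lab x = Decision v a b}"
proof -
  have "(e root, e x) \<in> (edges program)\<^sup>*" if "x \<in> reach" for x
    using that
  proof (induction rule: reach.induct)
    case (reach_child x y)
    then have "(e x, e y) \<in> edges program"
      by (auto simp: edges_program)
    then show ?case
      using reach_child.IH by simp
  qed simp
  moreover have "\<exists>x\<in>reach. u = e x" if "decision_on program u v" for u v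
    using that by (auto simp: decision_on_def nodes_program)
  ultimately show ?thesis
    unfolding bp_vars_def vars_below_def source_program
    by (force simp: decision_on_program)
qed

text \<open>As \<open>rank\<close> decreases along edges, the evaluation recursion has only one
  solution, so a guessed meaning \<open>g\<close> of the nodes need only be checked locally.\<close>

lemma holds_program:
  assumes g: "\<And>x. x \<in> U \<Longrightarrow> g x \<longleftrightarrow> (case lab x of Sink b \<Rightarrow> b
      | Decision v a b \<Rightarrow> (if \<alpha> v then g b else g a) | Conjunction a b \<Rightarrow> g a \<and> g b)"
    and "x \<in> reach"
  shows "holds program (e x) \<alpha> \<longleftrightarrow> g x"
  using assms(2)
proof (induction "rank x" arbitrary: x rule: less_induct)
  case less
  have IH: "holds program (e y) \<alpha> \<longleftrightarrow> g y" if "y \<in> children (lab x)" for y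
    using that less.hyps reach_child less.prems rank_child[OF reach_U[OF less.prems]] by blast
  have x: "e x \<in> nodes program"
    using less.prems by (simp add: nodes_program)
  show ?case
  proof (cases "lab x")
    case (Sink b)
    then show ?thesis
      using g[OF reach_U[OF less.prems]] holds_Sink[of program "e x" b] by (simp add: label_program)
  next
    case (Decision v a b)
    then have "label program (e x) = Decision v (e a) (e b)"
      by (simp add: label_program)
    then show ?thesis
      using g[OF reach_U[OF less.prems]] IH Decision
      by (simp add: holds_Decision[OF program_fbdd x])
  next
    case (Conjunction a b)
    then have "label program (e x) = Conjunction (e a) (e b)"
      by (simp add: label_program)
    then show ?thesis
      using g[OF reach_U[OF less.prems]] IH Conjunction
      by (simp add: holds_Conjunction[OF program_fbdd x])
  qed
qed

end


section \<open>A program for the selected matchings\<close>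

text \<open>The program reads the selectors in increasing order: \<open>Select k\<close> has found no true selector
  below \<open>k\<close>, and \<open>Selected c k\<close> has found only \<open>c\<close>. Then \<open>Matching c i\<close> is the conjunction of
  the clauses of matching \<open>c\<close> with smaller vertex at least \<open>i\<close>.\<close>

datatype matching_node =
  Const bool
| Vertex nat
| Edge nat nat
| Matching nat nat
| Selected nat nat
| Select nat

instance matching_node :: countable
  by countable_datatype

text \<open>A second 1-sink is forbidden, so the chains end in a conjunction of
  \<open>Const True\<close> with itself; \<open>Const True\<close> also pads conjunctions that have
  only one real child.\<close>

fun node_lab :: "nat \<Rightarrow> matching_node \<Rightarrow> (matching_node, nat) node_label" where
  "node_lab N (Const b) = Sink b"
| "node_lab N (Vertex j) = Decision (2 * N + j) (Const False) (Const True)"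
| "node_lab N (Edge i j) = Decision (2 * N + i) (Vertex j) (Const True)"
| "node_lab N (Matching c i) = (if i < N
     then Conjunction (if i < c - i \<and> c - i < N then Edge i (c - i) else Const True) (Matching c (Suc i))
     else Conjunction (Const True) (Const True))"
| "node_lab N (Selected c k) = (if k < 2 * N
     then Decision k (Selected c (Suc k)) (Const False)
     else Conjunction (Matching c 0) (Const True))"
| "node_lab N (Select k) = (if k < 2 * N
     then Decision k (Select (Suc k)) (Selected k (Suc k))
     else Conjunction (Const True) (Const True))"

fun valid_node :: "nat \<Rightarrow> matching_node \<Rightarrow> bool" where
  "valid_node N (Const b) \<longleftrightarrow> True"
| "valid_node N (Vertex j) \<longleftrightarrow> j < N"
| "valid_node N (Edge i j) \<longleftrightarrow> i < j \<and> j < N"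
| "valid_node N (Matching c i) \<longleftrightarrow> c < 2 * N \<and> i \<le> N"
| "valid_node N (Selected c k) \<longleftrightarrow> c < 2 * N \<and> k \<le> 2 * N"
| "valid_node N (Select k) \<longleftrightarrow> k \<le> 2 * N"

fun node_rank :: "nat \<Rightarrow> matching_node \<Rightarrow> nat" where
  "node_rank N (Const b) = 0"
| "node_rank N (Vertex j) = 1"
| "node_rank N (Edge i j) = 2"
| "node_rank N (Matching c i) = 3 + (N - i)"
| "node_rank N (Selected c k) = 4 + N + (2 * N - k)"
| "node_rank N (Select k) = 5 + N + (2 * N - k)"

text \<open>For \<open>Matching c i\<close> this is the interval of vertices from \<open>i\<close>
  to \<open>c - i\<close>. Its two ends form \<open>Edge i (c - i)\<close> and its interior is the
  scope of \<open>Matching c (Suc i)\<close>, whence decomposability. The crude \<open>{k..}\<close>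
  suffices for selectors because all vertex variables are larger.\<close>

fun node_scope :: "nat \<Rightarrow> matching_node \<Rightarrow> nat set" where
  "node_scope N (Const b) = {}"
| "node_scope N (Vertex j) = {2 * N + j}"
| "node_scope N (Edge i j) = {2 * N + i, 2 * N + j}"
| "node_scope N (Matching c i) = {v. 2 * N + i \<le> v \<and> v + i \<le> 2 * N + c}"
| "node_scope N (Selected c k) = {k..}"
| "node_scope N (Select k) = {k..}"

text \<open>In the \<open>Matching\<close> case, \<open>k < c - k\<close> already excludes a
  truncated subtraction.\<close>

fun node_value :: "nat \<Rightarrow> (nat \<Rightarrow> bool) \<Rightarrow> matching_node \<Rightarrow> bool" where
  "node_value N \<alpha> (Const b) \<longleftrightarrow> b"
| "node_value N \<alpha> (Vertex j) \<longleftrightarrow> \<alpha> (2 * N + j)"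
| "node_value N \<alpha> (Edge i j) \<longleftrightarrow> \<alpha> (2 * N + i) \<or> \<alpha> (2 * N + j)"
| "node_value N \<alpha> (Matching c i) \<longleftrightarrow>
     (\<forall>k\<ge>i. k < c - k \<and> c - k < N \<longrightarrow> \<alpha> (2 * N + k) \<or> \<alpha> (2 * N + (c - k)))"
| "node_value N \<alpha> (Selected c k) \<longleftrightarrow> (\<forall>d\<ge>k. d < 2 * N \<longrightarrow> \<not> \<alpha> d) \<and> matched N \<alpha> c"
| "node_value N \<alpha> (Select k) \<longleftrightarrow>
     (\<forall>c\<ge>k. \<forall>d>c. d < 2 * N \<longrightarrow> \<not> (\<alpha> c \<and> \<alpha> d)) \<and> (\<forall>c\<ge>k. c < 2 * N \<longrightarrow> \<alpha> c \<longrightarrow> matched N \<alpha> c)"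

lemma valid_nodes_subset: "{x. valid_node N x} \<subseteq>
    range Const \<union> Vertex ` {..<N} \<union> case_prod Edge ` ({..<N} \<times> {..<N}) \<union>
    case_prod Matching ` ({..<2 * N} \<times> {..N}) \<union>
    case_prod Selected ` ({..<2 * N} \<times> {..2 * N}) \<union> Select ` {..2 * N}"
proof
  fix x assume "x \<in> {x. valid_node N x}"
  then show "x \<in> range Const \<union> Vertex ` {..<N} \<union> case_prod Edge ` ({..<N} \<times> {..<N}) \<union>
    case_prod Matching ` ({..<2 * N} \<times> {..N}) \<union>
    case_prod Selected ` ({..<2 * N} \<times> {..2 * N}) \<union> Select ` {..2 * N}"
    by (cases x) force+
qed

lemma finite_valid_nodes: "finite {x. valid_node N x}"
  by (rule finite_subset[OF valid_nodes_subset]) simp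

lemma card_valid_nodes: "card {x. valid_node N x} \<le> 7 * N ^ 2 + 7 * N + 3"
proof -
  let ?V = "Vertex ` {..<N}"
  let ?E = "case_prod Edge ` ({..<N} \<times> {..<N})"
  let ?M = "case_prod Matching ` ({..<2 * N} \<times> {..N})"
  let ?S = "case_prod Selected ` ({..<2 * N} \<times> {..2 * N})"
  let ?T = "Select ` {..2 * N}"
  have "card {x. valid_node N x} \<le> card (range Const \<union> ?V \<union> ?E \<union> ?M \<union> ?S \<union> ?T)"
    by (rule card_mono[OF _ valid_nodes_subset]) simp
  also have "\<dots> \<le> card (range Const) + card ?V + card ?E + card ?M + card ?S + card ?T"
    by (intro order_trans[OF card_Un_le] add_right_mono order.refl)
  also have "\<dots> \<le> 2 + N + N * N + 2 * N * Suc N + 2 * N * Suc (2 * N) + Suc (2 * N)"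
    by (intro add_mono order_trans[OF card_image_le]) (simp_all add: card_cartesian_product)
  also have "\<dots> = 7 * N ^ 2 + 7 * N + 3"
    by (simp add: power2_eq_square algebra_simps)
  finally show ?thesis .
qed

lemma layout_matching:
  "layout (to_nat :: matching_node \<Rightarrow> nat) (node_lab N) (Select 0) {x. valid_node N x}
    (node_rank N) (node_scope N)"
proof
  fix x y assume "x \<in> {x. valid_node N x}" and y: "y \<in> children (node_lab N x)"
  then have x: "valid_node N x"
    by simp
  show "y \<in> {x. valid_node N x}"
    using x y by (cases x) (auto split: if_splits)
  show "node_rank N y < node_rank N x"
    using x y by (cases x) (auto split: if_splits)
  show "node_scope N y \<subseteq> node_scope N x"
    using x y by (cases x) (auto split: if_splits)
next
  fix x v a b assume "x \<in> {x. valid_node N x}" and lab: "node_lab N x = Decision v a b"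
  then have x: "valid_node N x"
    by simp
  show "v \<in> node_scope N x"
    using x lab by (cases x) (auto split: if_splits)
  show "v < w" if "w \<in> node_scope N a \<union> node_scope N b" for w
    using x lab that by (cases x) (auto split: if_splits)
next
  fix x a b assume "x \<in> {x. valid_node N x}" and lab: "node_lab N x = Conjunction a b"
  then show "node_scope N a \<inter> node_scope N b = {}"
    by (cases x) (auto split: if_splits)
next
  fix x y b assume "node_lab N x = Sink b" "node_lab N y = Sink b"
  then show "x = y"
    by (cases x; cases y) (auto split: if_splits)
qed (simp_all add: finite_valid_nodes)

lemma node_value_recursion:
  assumes "valid_node N x"
  shows "node_value N \<alpha> x \<longleftrightarrow> (case node_lab N x of Sink b \<Rightarrow> b
      | Decision v a b \<Rightarrow> (if \<alpha> v then node_value N \<alpha> b else node_value N \<alpha> a)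
      | Conjunction a b \<Rightarrow> node_value N \<alpha> a \<and> node_value N \<alpha> b)"
proof (cases x)
  case (Matching c i)
  have "(\<forall>k\<ge>i. Q k) \<longleftrightarrow> Q i \<and> (\<forall>k\<ge>Suc i. Q k)" for Q :: "nat \<Rightarrow> bool"
    by (metis Suc_leD dual_order.refl le_antisym not_less_eq_eq)
  note split = this[of "\<lambda>k. k < c - k \<and> c - k < N \<longrightarrow> \<alpha> (2 * N + k) \<or> \<alpha> (2 * N + (c - k))"]
  show ?thesis
  proof (cases "i < N")
    case True
    then show ?thesis
      using Matching split by auto
  qed (use Matching in auto)
next
  case (Selected c k)
  have "node_value N \<alpha> (Matching c 0) \<longleftrightarrow> matched N \<alpha> c"
  proof
    assume *: "node_value N \<alpha> (Matching c 0)"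
    show "matched N \<alpha> c"
      unfolding matched_def
    proof (intro allI impI)
      fix i j assume "i < j \<and> j < N \<and> i + j = c"
      then have "j = c - i" "i < c - i" "c - i < N"
        by auto
      moreover have "\<alpha> (2 * N + i) \<or> \<alpha> (2 * N + (c - i))" if "i < c - i" "c - i < N"
        using * le0[of i] that unfolding node_value.simps by blast
      ultimately show "\<alpha> (2 * N + i) \<or> \<alpha> (2 * N + j)"
        by blast
    qed
  next
    assume *: "matched N \<alpha> c"
    have "\<alpha> (2 * N + k) \<or> \<alpha> (2 * N + (c - k))" if "k < c - k" "c - k < N" for k
      using *[unfolded matched_def, rule_format, of k "c - k"] that by simp
    then show "node_value N \<alpha> (Matching c 0)"
      unfolding node_value.simps by blast
  qed
  moreover have "(\<forall>d\<ge>k. d < 2 * N \<longrightarrow> \<not> \<alpha> d) \<longleftrightarrow>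
      (k < 2 * N \<longrightarrow> \<not> \<alpha> k) \<and> (\<forall>d\<ge>Suc k. d < 2 * N \<longrightarrow> \<not> \<alpha> d)"
    by (metis Suc_leD dual_order.refl le_antisym not_less_eq_eq)
  ultimately show ?thesis
    using Selected by auto
next
  case (Select k)
  have split: "(\<forall>d\<ge>k. Q d) \<longleftrightarrow> Q k \<and> (\<forall>d\<ge>Suc k. Q d)" for Q :: "nat \<Rightarrow> bool"
    by (metis Suc_leD dual_order.refl le_antisym not_less_eq_eq)
  show ?thesis
  proof (cases "k < 2 * N")
    case True
    \<comment> \<open>If selector \<open>k\<close> is true, the condition shrinks to: no later
      selector is true and matching \<open>k\<close> is covered. This is the value of
      \<open>Selected k (Suc k)\<close>.\<close>
    then show ?thesis
      unfolding Select node_value.simps split by (auto simp: Suc_le_eq)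
  qed (use Select in auto)
qed (use assms in auto)

lemma matching_wedge_d_obdd:
  assumes N: "2 \<le> N"
  shows "\<exists>B :: (nat, nat) bp. is_wedge_d_obdd B \<and> represents B (cnf_function (matching_cnf N)) \<and>
    bp_size B \<le> 7 * N ^ 2 + 7 * N + 3"
proof -
  interpret layout "to_nat :: matching_node \<Rightarrow> nat" "node_lab N" "Select 0" "{x. valid_node N x}"
    "node_rank N" "node_scope N"
    by (rule layout_matching)
  have "holds program (source program) \<alpha> \<longleftrightarrow> cnf_holds (matching_cnf N) \<alpha>" for \<alpha>
  proof -
    have "holds program (source program) \<alpha> \<longleftrightarrow> node_value N \<alpha> (Select 0)"
      unfolding source_program
      by (rule holds_program[OF node_value_recursion reach_root]) simp
    then show ?thesis
      by (auto simp: cnf_holds_matching_cnf)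
  qed
  moreover have "bp_vars program = {..<3 * N}"
  proof
    show "bp_vars program \<subseteq> {..<3 * N}"
    proof
      fix v assume "v \<in> bp_vars program"
      then obtain x a b where "x \<in> reach" and lab: "node_lab N x = Decision v a b"
        by (auto simp: bp_vars_program)
      then have "valid_node N x"
        using reach_U by auto
      then show "v \<in> {..<3 * N}"
        using lab by (cases x) (auto split: if_splits)
    qed
    \<comment> \<open>\<open>bp_vars\<close> sees only reachable nodes, so each variable needs a
      reachable node that reads it; the chains of selectors and matchings lead to every
      pair.\<close>
    have select: "Select k \<in> reach" if "k \<le> 2 * N" for k
      using that
    proof (induction k)
      case (Suc k)
      then show ?case
        using reach_child[of "Select k" "Select (Suc k)"] by simp
    qed (rule reach_root)
    have selected: "Selected c k \<in> reach" if "Suc c \<le> k" "k \<le> 2 * N" for c k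
      using that
    proof (induction k rule: dec_induct)
      case base
      then show ?case
        using select[of c] reach_child[of "Select c" "Selected c (Suc c)"] by simp
    next
      case (step k)
      then show ?case
        using reach_child[of "Selected c k" "Selected c (Suc k)"] by simp
    qed
    have matching: "Matching c i \<in> reach" if "c < 2 * N" "i \<le> N" for c i
      using that(2)
    proof (induction i)
      case 0
      then show ?case
        using selected[of c "2 * N"] that(1) reach_child[of "Selected c (2 * N)" "Matching c 0"]
        by simp
    next
      case (Suc i)
      then show ?case
        using reach_child[of "Matching c i" "Matching c (Suc i)"] by simp
    qed
    have edge: "Edge i j \<in> reach" if "i < j" "j < N" for i j
      using that matching[of "i + j" i] reach_child[of "Matching (i + j) i" "Edge i j"] by simp
    have vertex: "Vertex j \<in> reach" if "0 < j" "j < N" for j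
      using edge[of 0 j] that reach_child[of "Edge 0 j" "Vertex j"] by simp
    show "{..<3 * N} \<subseteq> bp_vars program"
    proof
      fix v assume v: "v \<in> {..<3 * N}"
      consider "v < 2 * N" | "v = 2 * N" | "2 * N < v"
        by linarith
      then show "v \<in> bp_vars program"
      proof cases
        case 1
        then show ?thesis
          using select[of v] by (force simp: bp_vars_program)
      next
        \<comment> \<open>Vertex 0 is never the larger end of a pair, so its variable is read only
          at nodes \<open>Edge 0 j\<close>.\<close>
        case 2
        then show ?thesis
          using edge[of 0 1] N by (force simp: bp_vars_program)
      next
        case 3
        then show ?thesis
          using vertex[of "v - 2 * N"] v by (force simp: bp_vars_program)
      qed
    qed
  qed
  ultimately have "represents program (cnf_function (matching_cnf N))"
    by (simp add: represents_cnf_iff[OF program_fbdd] cnf_vars_matching_cnf N)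
  then show ?thesis
    using program_obdd bp_size_program card_valid_nodes[of N] by (meson order_trans)
qed

theorem theorem3:
  shows "\<exists>\<Phi> :: nat cnf set.
    infinite \<Phi> \<and> (\<forall>\<phi>\<in>\<Phi>. is_cnf \<phi>) \<and> (\<forall>n. \<exists>\<phi>\<in>\<Phi>. n \<le> card (cnf_vars \<phi>)) \<and>
    (\<exists>p :: nat poly. \<forall>\<phi>\<in>\<Phi>. \<exists>B :: (nat, nat) bp.
        is_wedge_d_obdd B \<and> represents B (cnf_function \<phi>) \<and>
        bp_size B \<le> poly p (card (cnf_vars \<phi>))) \<and>
    (\<exists>c > 0. \<exists>d > 0. \<forall>\<phi>\<in>\<Phi>. \<forall>B :: (nat, nat) bp.
        is_obdd B \<and> represents B (cnf_function \<phi>) \<longrightarrow>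
        real (bp_size B) \<ge> 2 powr (d * real (card (cnf_vars \<phi>)) powr c))"
proof -
  \<comment> \<open>The number of vertices is even so that a cut can halve them, and at least 2 so
    that all variables occur.\<close>
  define F where "F m = matching_cnf (2 * Suc m)" for m
  have vars: "card (cnf_vars (F m)) = 6 * Suc m" for m
    by (simp add: F_def cnf_vars_matching_cnf)
  have "inj F"
    by (rule injI) (use vars in \<open>metis Suc_inject mult_cancel1 zero_neq_numeral\<close>)
  then have inf: "infinite (range F)"
    by (rule range_inj_infinite)
  have unbounded: "n \<le> card (cnf_vars (F n))" for n
    by (simp add: vars)
  have upper: "\<exists>B :: (nat, nat) bp. is_wedge_d_obdd B \<and> represents B (cnf_function (F m)) \<and>
      bp_size B \<le> poly [:3, 3, 1:] (card (cnf_vars (F m)))" for m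
  proof -
    obtain B :: "(nat, nat) bp" where B: "is_wedge_d_obdd B" "represents B (cnf_function (F m))"
      and size: "bp_size B \<le> 7 * (2 * Suc m) ^ 2 + 7 * (2 * Suc m) + 3"
      using matching_wedge_d_obdd[of "2 * Suc m"] unfolding F_def by auto
    \<comment> \<open>With \<open>n = 3 * N\<close> variables, \<open>n ^ 2 + 3 * n + 3\<close>
      equals \<open>9 * N ^ 2 + 9 * N + 3\<close>.\<close>
    have "7 * (2 * Suc m) ^ 2 + 7 * (2 * Suc m) + 3 \<le> poly [:3, 3, 1:] (card (cnf_vars (F m)))"
      unfolding vars by (simp add: power2_eq_square algebra_simps)
    then show ?thesis
      using B size by (meson order_trans)
  qed
  have lower: "2 powr (1 / 24 * real (card (cnf_vars (F m))) powr 1) \<le> real (bp_size B)"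
    if B: "is_obdd B" "represents B (cnf_function (F m))" for m and B :: "(nat, nat) bp"
  proof -
    obtain k where k: "Suc m \<le> 4 * k" "2 ^ k \<le> bp_size B"
      using matching_obdd_size[of "Suc m" B] B unfolding F_def by auto
    \<comment> \<open>The fraction \<open>1 / 24\<close> of \<open>6 * Suc m\<close> variables is
      \<open>Suc m / 4\<close>, which is at most \<open>k\<close>.\<close>
    have "2 powr (1 / 24 * real (card (cnf_vars (F m))) powr 1) \<le> 2 powr real k"
      using k(1) unfolding vars by (intro powr_mono) auto
    also have "\<dots> = real (2 ^ k)"
      by (simp add: powr_realpow)
    also have "\<dots> \<le> real (bp_size B)"
      using k(2) by (simp only: of_nat_le_iff)
    finally show ?thesis .
  qed
  show ?thesis
  proof (intro exI[of _ "range F"] conjI)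
    show "\<forall>\<phi>\<in>range F. is_cnf \<phi>"
      by (auto simp: F_def is_cnf_matching_cnf)
    show "\<exists>p :: nat poly. \<forall>\<phi>\<in>range F. \<exists>B :: (nat, nat) bp.
        is_wedge_d_obdd B \<and> represents B (cnf_function \<phi>) \<and> bp_size B \<le> poly p (card (cnf_vars \<phi>))"
      using upper by (intro exI[of _ "[:3, 3, 1:]"]) blast
    show "\<exists>c > 0. \<exists>d > 0. \<forall>\<phi>\<in>range F. \<forall>B :: (nat, nat) bp.
        is_obdd B \<and> represents B (cnf_function \<phi>) \<longrightarrow>
        real (bp_size B) \<ge> 2 powr (d * real (card (cnf_vars \<phi>)) powr c)"
      using lower by (intro exI[of _ 1] exI[of _ "1 / 24"] conjI) auto
  qed (use inf unbounded in blast)+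
qed

end
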